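(* Let $k\ge 4$ and consider the Game of Cycles on the $1$-$2$-$k$ graph. Player 1 has a winning strategy when $k$ is even, and Player 2 has a winning strategy when $k$ is odd.
   Context: Game of Cycles: the gameboard is a simple connected graph drawn in the plane without crossings. Players 1 and 2 alternate turns, Player 1 first; on a turn a player must, if possible, direct one currently undirected edge, and it is illegal to create a sink (a vertex all of whose incident edges point into it) or a source (a vertex all of whose incident edges point out of it). A cycle cell is a cycle of the graph bounding a bounded face of the drawing; a player who directs an edge so that all edges of some cycle cell are directed consistently around it wins immediately. Otherwise the player who makes the last legal move wins. A $j$-$2$-$k$ graph consists of two vertices joined by three internally disjoint paths: an upper path with $j$ edges, a middle path with $2$ edges, and a lower path with $k$ edges, all other vertices having degree $2$; it is drawn with the middle path between the upper and lower paths, so its cycle cells are the $(j+2)$-cycle formed by the upper and middle paths and the $(k+2)$-cycle formed by the middle and lower paths. (For $j=1$ the upper path is a single edge joining the two degree-3 vertices, and the upper cycle cell is a triangle.) *)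

theory Defs
  imports Main
begin

section \<open>Gameboards\<close>

text \<open>
  The rules refer to the plane drawing only through the set of its cycle cells, so a gameboard
  records a graph together with its cycle cells.  A cell is given by listing the vertices of its
  boundary cycle once, in cyclic order; starting point and orientation of the list are irrelevant.
\<close>

record 'v board =
  verts :: "'v set"
  edges :: "'v set set"
  cells :: "'v list set"

definition is_cycle :: "'v set set \<Rightarrow> 'v list \<Rightarrow> bool" where
  "is_cycle E c \<longleftrightarrow> 3 \<le> length c \<and> distinct c \<and>
     (\<forall>i < length c. {c ! i, c ! (Suc i mod length c)} \<in> E)"

definition gameboard :: "'v board \<Rightarrow> bool" where
  "gameboard G \<longleftrightarrow>
     finite (verts G) \<and> verts G \<noteq> {} \<and>
     (\<forall>e \<in> edges G. e \<subseteq> verts G \<and> card e = 2) \<and>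
     (\<forall>u \<in> verts G. \<forall>v \<in> verts G. (u, v) \<in> {(x, y). {x, y} \<in> edges G}\<^sup>*) \<and>
     (\<forall>c \<in> cells G. is_cycle (edges G) c)"


section \<open>The Game of Cycles\<close>

text \<open>
  A move \<open>(u, v)\<close> directs the edge \<open>{u, v}\<close> from \<open>u\<close> to \<open>v\<close>; a position is the set of moves made.
\<close>

type_synonym 'v move = "'v \<times> 'v"

definition is_sink :: "'v board \<Rightarrow> 'v move set \<Rightarrow> 'v \<Rightarrow> bool" where
  "is_sink G D v \<longleftrightarrow> (\<forall>u. {u, v} \<in> edges G \<longrightarrow> (u, v) \<in> D)"

definition is_source :: "'v board \<Rightarrow> 'v move set \<Rightarrow> 'v \<Rightarrow> bool" where
  "is_source G D v \<longleftrightarrow> (\<forall>u. {v, u} \<in> edges G \<longrightarrow> (v, u) \<in> D)"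

definition legal_move :: "'v board \<Rightarrow> 'v move set \<Rightarrow> 'v move \<Rightarrow> bool" where
  "legal_move G D m \<longleftrightarrow>
     {fst m, snd m} \<in> edges G \<and> m \<notin> D \<and> (snd m, fst m) \<notin> D \<and>
     (\<forall>w \<in> verts G. \<not> is_sink G (insert m D) w \<and> \<not> is_source G (insert m D) w)"

definition directed_around :: "'v move set \<Rightarrow> 'v list \<Rightarrow> bool" where
  "directed_around D c \<longleftrightarrow>
     (\<forall>i < length c. (c ! i, c ! (Suc i mod length c)) \<in> D) \<or>
     (\<forall>i < length c. (c ! (Suc i mod length c), c ! i) \<in> D)"

definition has_cycle_cell :: "'v board \<Rightarrow> 'v move set \<Rightarrow> bool" where
  "has_cycle_cell G D \<longleftrightarrow> (\<exists>c \<in> cells G. directed_around D c)"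

definition game_over :: "'v board \<Rightarrow> 'v move set \<Rightarrow> bool" where
  "game_over G D \<longleftrightarrow> has_cycle_cell G D \<or> (\<nexists>m. legal_move G D m)"

text \<open>The (possibly unfinished) plays, as lists of moves in chronological order.\<close>

inductive play :: "'v board \<Rightarrow> 'v move list \<Rightarrow> bool" for G where
  start: "play G []"
| move: "\<lbrakk>play G h; \<not> game_over G (set h); legal_move G (set h) m\<rbrakk> \<Longrightarrow> play G (h @ [m])"

datatype player = Player1 | Player2

definition to_move :: "'v move list \<Rightarrow> player" where
  "to_move h = (if even (length h) then Player1 else Player2)"

text \<open>
  Play stops as soon as a cycle cell is directed consistently, so the player completing a cell
  has made the last move.  Both ways of winning therefore credit the maker of the last move of a
  finished play.  (A play without any move is won by nobody.)
\<close>

definition won_by :: "'v board \<Rightarrow> 'v move list \<Rightarrow> player \<Rightarrow> bool" where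
  "won_by G h p \<longleftrightarrow> game_over G (set h) \<and> h \<noteq> [] \<and> to_move (butlast h) = p"

type_synonym 'v strategy = "'v move list \<Rightarrow> 'v move"

definition follows :: "player \<Rightarrow> 'v strategy \<Rightarrow> 'v move list \<Rightarrow> bool" where
  "follows p \<sigma> h \<longleftrightarrow> (\<forall>n < length h. to_move (take n h) = p \<longrightarrow> h ! n = \<sigma> (take n h))"

text \<open>
  Demanding a legal answer whenever it is \<open>p\<close>'s turn is essential: otherwise a strategy could
  win vacuously by answering with an illegal move.  As every move directs a further edge, all
  plays on a finite board end.
\<close>

definition winning_strategy :: "'v board \<Rightarrow> player \<Rightarrow> 'v strategy \<Rightarrow> bool" where
  "winning_strategy G p \<sigma> \<longleftrightarrow>
     (\<forall>h. play G h \<and> follows p \<sigma> h \<longrightarrow>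
        (if game_over G (set h) then won_by G h p
         else to_move h = p \<longrightarrow> legal_move G (set h) (\<sigma> h)))"

definition has_winning_strategy :: "'v board \<Rightarrow> player \<Rightarrow> bool" where
  "has_winning_strategy G p \<longleftrightarrow> (\<exists>\<sigma>. winning_strategy G p \<sigma>)"


section \<open>The j-2-k graphs\<close>

datatype vertex = LeftEnd | RightEnd | Upper nat | Middle | Lower nat

text \<open>Paths are given by their vertex sequences; a path with \<open>n\<close> edges has \<open>n - 1\<close> inner vertices.\<close>

definition upper_path :: "nat \<Rightarrow> vertex list" where
  "upper_path j = LeftEnd # map Upper [1..<j] @ [RightEnd]"

definition middle_path :: "vertex list" where
  "middle_path = [LeftEnd, Middle, RightEnd]"

definition lower_path :: "nat \<Rightarrow> vertex list" where
  "lower_path k = LeftEnd # map Lower [1..<k] @ [RightEnd]"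

definition path_edges :: "'v list \<Rightarrow> 'v set set" where
  "path_edges p = {{p ! i, p ! Suc i} | i. Suc i < length p}"

text \<open>
  The cells go along the upper (lower) path from left to right and return through the middle
  vertex.  The definition is meant for \<open>j, k \<ge> 1\<close>, not both \<open>1\<close> (the graph would not be simple).
\<close>

definition j2k_graph :: "nat \<Rightarrow> nat \<Rightarrow> vertex board" where
  "j2k_graph j k =
     \<lparr>verts = set (upper_path j) \<union> set middle_path \<union> set (lower_path k),
      edges = path_edges (upper_path j) \<union> path_edges middle_path \<union> path_edges (lower_path k),
      cells = {upper_path j @ [Middle], lower_path k @ [Middle]}\<rparr>"


text \<open>Sanity check: these are indeed gameboards.\<close>

lemma path_edges_two:
  assumes "distinct p" "e \<in> path_edges p"
  shows "e \<subseteq> set p \<and> card e = 2"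
proof -
  obtain i where i: "e = {p ! i, p ! Suc i}" "Suc i < length p"
    using assms(2) by (auto simp: path_edges_def)
  moreover have "p ! i \<noteq> p ! Suc i"
    using i assms(1) by (simp add: nth_eq_iff_index_eq)
  ultimately show ?thesis by simp
qed

lemma path_edges_reach:
  assumes "path_edges p \<subseteq> E" "i < length p"
  shows "(p ! 0, p ! i) \<in> {(x, y). {x, y} \<in> E}\<^sup>*"
  using assms(2)
proof (induction i)
  case (Suc i)
  then have "{p ! i, p ! Suc i} \<in> E"
    using assms(1) by (auto simp: path_edges_def)
  then show ?case
    using Suc by (auto intro: rtrancl_into_rtrancl)
qed simp

lemma is_cycle_append:
  assumes "path_edges p \<subseteq> E" "distinct p" "2 \<le> length p" "x \<notin> set p"
    and "{last p, x} \<in> E" "{x, hd p} \<in> E"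
  shows "is_cycle E (p @ [x])"
  unfolding is_cycle_def
proof (intro conjI allI impI)
  fix i assume i: "i < length (p @ [x])"
  consider "Suc i < length p" | "Suc i = length p" | "i = length p"
    using i by fastforce
  then show "{(p @ [x]) ! i, (p @ [x]) ! (Suc i mod length (p @ [x]))} \<in> E"
  proof cases
    case 1
    then show ?thesis using assms(1) by (auto simp: path_edges_def nth_append)
  next
    case 2
    then have "i = length p - 1" "p \<noteq> []" by auto
    then show ?thesis using assms(5) 2 by (simp add: nth_append last_conv_nth)
  next
    case 3
    moreover have "p \<noteq> []" using assms(3) by auto
    ultimately show ?thesis using assms(6) by (simp add: nth_append hd_conv_nth)
  qed
qed (use assms in auto)

lemma distinct_paths: "distinct (upper_path j)" "distinct middle_path" "distinct (lower_path k)"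
  by (auto simp: upper_path_def middle_path_def lower_path_def distinct_map inj_on_def)

lemma middle_path_edges: "path_edges middle_path = {{LeftEnd, Middle}, {Middle, RightEnd}}"
proof -
  have "{i. Suc i < length middle_path} = {0, 1}"
    by (auto simp: middle_path_def)
  moreover have "path_edges middle_path =
      (\<lambda>i. {middle_path ! i, middle_path ! Suc i}) ` {i. Suc i < length middle_path}"
    by (auto simp: path_edges_def)
  ultimately show ?thesis by (simp add: middle_path_def)
qed

lemma gameboard_j2k_graph: "gameboard (j2k_graph j k)"
proof -
  let ?G = "j2k_graph j k"
  let ?R = "{(x, y). {x, y} \<in> edges ?G}\<^sup>*"
  have reach: "(LeftEnd, v) \<in> ?R" if v: "v \<in> verts ?G" for v
  proof -
    obtain p where p: "p \<in> {upper_path j, middle_path, lower_path k}" "v \<in> set p"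
      using v by (auto simp: j2k_graph_def)
    then obtain i where "i < length p" "v = p ! i" by (metis in_set_conv_nth)
    moreover have "path_edges p \<subseteq> edges ?G" "p ! 0 = LeftEnd"
      using p(1) by (auto simp: j2k_graph_def upper_path_def middle_path_def lower_path_def)
    ultimately show ?thesis using path_edges_reach[of p "edges ?G" i] by simp
  qed
  have "sym {(x, y). {x, y} \<in> edges ?G}"
    by (auto simp: sym_def insert_commute)
  then have "sym ?R" by (rule sym_rtrancl)
  then have conn: "(u, v) \<in> ?R" if "u \<in> verts ?G" "v \<in> verts ?G" for u v
    using reach that by (meson rtrancl_trans symD)
  have simple: "e \<subseteq> verts ?G \<and> card e = 2" if "e \<in> edges ?G" for e
    using that path_edges_two[OF distinct_paths(1), of e j] path_edges_two[OF distinct_paths(2), of e]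
      path_edges_two[OF distinct_paths(3), of e k]
    by (auto simp: j2k_graph_def)
  have "is_cycle (edges ?G) (p @ [Middle])" if "p \<in> {upper_path j, lower_path k}" for p
  proof (rule is_cycle_append)
    show "path_edges p \<subseteq> edges ?G" using that by (auto simp: j2k_graph_def)
    show "distinct p" using that distinct_paths by auto
    show "2 \<le> length p" "Middle \<notin> set p"
      using that by (auto simp: upper_path_def lower_path_def)
    have "last p = RightEnd" "hd p = LeftEnd"
      using that by (auto simp: upper_path_def lower_path_def)
    then show "{last p, Middle} \<in> edges ?G" "{Middle, hd p} \<in> edges ?G"
      by (auto simp: j2k_graph_def middle_path_edges insert_commute)
  qed
  then have cyc: "\<forall>c \<in> cells ?G. is_cycle (edges ?G) c"
    by (auto simp: j2k_graph_def)
  have "finite (verts ?G)" "verts ?G \<noteq> {}"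
    by (auto simp: j2k_graph_def middle_path_def)
  then show ?thesis
    using conn simple cyc unfolding gameboard_def by blast
qed

end

theory Submission
  imports Defs
begin

text \<open>
  After the first round (for Player 1, after his first move) the claimed winner can have the chord,
  i.e. the upper edge, directed, say in direction \<open>t\<close>, with no middle edge continuing it around the
  triangle.  If the opponent later directs a middle edge that way, the winner completes the
  triangle; the winner himself makes any other legal move.  One always exists, by parity: when only
  moves continuing the chord around the triangle are left, the undirected edges of the other
  \<open>k + 2\<close> are exactly the places where the direction changes along the lower path extended by the
  middle edges.  Since both extremes effectively have the direction \<open>\<not> t\<close>, there is an even
  number of them.
\<close>

section \<open>Winning strategies from invariants\<close>

text \<open>\<open>Inv\<close> describes the positions in which the opponent of \<open>p\<close> is
  to move. The strategy chooses any legal move that restores \<open>Inv\<close>. Since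
  \<open>reply\<close> excludes that the game is over when \<open>p\<close> is to move, a finished
  play always ends with a move of \<open>p\<close>. Finished positions may satisfy
  \<open>Inv\<close> as well, as no reply is asked for there.\<close>

lemma has_winning_strategyI:
  assumes reply: "\<And>D m. Inv D \<Longrightarrow> \<not> game_over G D \<Longrightarrow> legal_move G D m \<Longrightarrow>
      \<not> game_over G (insert m D) \<and>
      (\<exists>m'. legal_move G (insert m D) m' \<and> Inv (insert m' (insert m D)))"
    and start: "\<not> game_over G {}"
    and first: "p = Player1 \<Longrightarrow> \<exists>m. legal_move G {} m \<and> Inv {m}"
    and second: "p = Player2 \<Longrightarrow> Inv {}"
  shows "has_winning_strategy G p"
proof -
  define good where "good h m \<longleftrightarrow> legal_move G (set h) m \<and> Inv (insert m (set h))" for h m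
  define \<sigma> where "\<sigma> h = (SOME m. good h m)" for h
  have inv: "if to_move h = p then \<not> game_over G (set h) \<and> good h (\<sigma> h) else Inv (set h)"
    if "play G h" "follows p \<sigma> h" for h
    using that
  proof (induction rule: play.induct)
    case start
    show ?case
    proof (cases p)
      case Player1
      then have "\<exists>m. good [] m" using first by (auto simp: good_def)
      then show ?thesis using Player1 \<open>\<not> game_over G {}\<close> someI_ex[of "good []"]
        by (simp add: to_move_def \<sigma>_def)
    next
      case Player2
      then show ?thesis using second by (simp add: to_move_def)
    qed
  next
    case (move h m)
    have fol: "follows p \<sigma> h"
      unfolding follows_def
    proof (intro allI impI)
      fix n assume "n < length h" "to_move (take n h) = p"
      then show "h ! n = \<sigma> (take n h)"
        using move.prems unfolding follows_def
        by (auto simp: nth_append dest!: spec[of _ n])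
    qed
    note IH = move.IH[OF fol]
    show ?case
    proof (cases "to_move h = p")
      case True
      then have "m = \<sigma> h"
        using move.prems unfolding follows_def by (auto dest!: spec[of _ "length h"])
      moreover have "to_move (h @ [m]) \<noteq> p"
        using True by (auto simp: to_move_def split: if_splits)
      ultimately show ?thesis using IH True by (simp add: good_def)
    next
      case False
      then have "to_move (h @ [m]) = p"
        by (cases p) (auto simp: to_move_def split: if_splits)
      moreover have "\<not> game_over G (set (h @ [m])) \<and> (\<exists>m'. good (h @ [m]) m')"
        using reply[of "set h" m] IH False move.hyps by (simp add: good_def)
      ultimately show ?thesis using someI_ex[of "good (h @ [m])"] by (simp add: \<sigma>_def)
    qed
  qed
  have "winning_strategy G p \<sigma>"
    unfolding winning_strategy_def
  proof (intro allI impI)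
    fix h assume h: "play G h \<and> follows p \<sigma> h"
    show "if game_over G (set h) then won_by G h p
          else to_move h = p \<longrightarrow> legal_move G (set h) (\<sigma> h)"
    proof (cases "to_move h = p")
      case True
      then show ?thesis using inv[of h] h by (simp add: good_def)
    next
      case False
      \<comment> \<open>The opponent is to move, so the last move, if there was one, came from
        \<open>p\<close>. The empty play is unfinished by \<open>start\<close>.\<close>
      then have "to_move (butlast h) = p" if "h \<noteq> []"
        using that by (cases p; cases h rule: rev_cases) (auto simp: to_move_def split: if_splits)
      then show ?thesis using False start by (cases "h = []") (auto simp: won_by_def)
    qed
  qed
  then show ?thesis by (auto simp: has_winning_strategy_def)
qed

section \<open>Parity of the number of direction changes\<close>

text \<open>Read from left to right, the value is constant across adjacent defined entries and flips
  at each gap, so gaps count sign changes between \<open>a\<close> and \<open>b\<close>. The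
  induction removes the last entry, or the last entry together with the gap before it; the second
  case is why it is strong induction.\<close>

lemma even_gaps:
  fixes y :: "nat \<Rightarrow> bool option"
  assumes "y 0 = Some a" "y n = Some b"
    and adj: "\<And>i s. i < n \<Longrightarrow> y i = Some s \<Longrightarrow> y (Suc i) \<noteq> Some (\<not> s)"
    and gap: "\<And>i. Suc i < n \<Longrightarrow> y (Suc i) = None \<Longrightarrow>
      \<exists>s. y i = Some s \<and> y (Suc (Suc i)) = Some (\<not> s)"
  shows "even (card {i. i < n \<and> y i = None}) \<longleftrightarrow> a = b"
  using assms
proof (induction n arbitrary: b rule: less_induct)
  case (less n)
  show ?case
  proof (cases n)
    case 0
    then show ?thesis using less.prems by simp
  next
    case (Suc m)
    show ?thesis
    proof (cases "y m")
      case (Some c)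
      then have "c = b" using less.prems(3)[of m c] less.prems(2) Suc by auto
      moreover have "even (card {i. i < m \<and> y i = None}) \<longleftrightarrow> a = c"
        using less.IH[of m c] less.prems Some Suc by simp
      moreover have "{i. i < n \<and> y i = None} = {i. i < m \<and> y i = None}"
        using Suc Some by (auto simp: less_Suc_eq)
      ultimately show ?thesis by simp
    next
      case None
      then obtain l where l: "m = Suc l" using less.prems(1) by (cases m) auto
      then have yl: "y l = Some (\<not> b)" using less.prems(4)[of l] less.prems(2) None Suc by auto
      then have "even (card {i. i < l \<and> y i = None}) \<longleftrightarrow> a = (\<not> b)"
        using less.IH[of l "\<not> b"] less.prems Suc l by simp
      moreover have "{i. i < n \<and> y i = None} = insert m {i. i < l \<and> y i = None}"
        using Suc None l yl by (auto simp: less_Suc_eq)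
      moreover have "m \<notin> {i. i < l \<and> y i = None}" using l by simp
      ultimately show ?thesis by simp
    qed
  qed
qed

section \<open>Positions in rim coordinates\<close>

text \<open>
  The rim is the boundary cycle of the lower cell: it starts at the middle vertex, and arc \<open>0\<close> and
  arc \<open>k + 1\<close> are the two middle edges.
\<close>

definition rim :: "nat \<Rightarrow> nat \<Rightarrow> vertex" where
  "rim k i = (if i = 0 \<or> i = k + 2 then Middle else if i = 1 then LeftEnd
     else if i = k + 1 then RightEnd else Lower (i - 1))"

definition arc :: "nat \<Rightarrow> bool \<Rightarrow> nat \<Rightarrow> vertex move" where
  "arc k s i = (if s then (rim k i, rim k (Suc i)) else (rim k (Suc i), rim k i))"

text \<open>The sign is chosen so that \<open>chord s\<close> can replace the lower path in the rim
  directed by \<open>s\<close>. Thus a directed triangle consists of \<open>chord s\<close>,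
  \<open>arc k s 0\<close> and \<open>arc k s (k + 1)\<close> with one common
  \<open>s\<close>.\<close>

definition chord :: "bool \<Rightarrow> vertex move" where
  "chord s = (if s then (LeftEnd, RightEnd) else (RightEnd, LeftEnd))"

definition marked :: "nat \<Rightarrow> vertex move set \<Rightarrow> nat \<Rightarrow> bool" where
  "marked k D i \<longleftrightarrow> (\<exists>s. arc k s i \<in> D)"

text \<open>Positions are arbitrary sets of moves. This condition, preserved by legal moves, makes
  the direction of an edge and the count of directed edges meaningful.\<close>

definition oriented :: "nat \<Rightarrow> vertex move set \<Rightarrow> bool" where
  "oriented k D \<longleftrightarrow> D \<subseteq> (\<lambda>(s, i). arc k s i) ` (UNIV \<times> {..k + 1}) \<union> range chord \<and>
     (\<forall>i \<le> k + 1. \<not> (arc k True i \<in> D \<and> arc k False i \<in> D)) \<and>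
     \<not> (chord True \<in> D \<and> chord False \<in> D)"

text \<open>Absence of sinks and sources, in rim coordinates. The clauses concern in turn the middle
  vertex, the inner vertices of the lower path, \<open>LeftEnd\<close> and \<open>RightEnd\<close>;
  the two values of \<open>s\<close> distinguish sink from source.\<close>

definition balanced :: "nat \<Rightarrow> vertex move set \<Rightarrow> bool" where
  "balanced k D \<longleftrightarrow> (\<forall>s.
     \<not> (arc k s (k + 1) \<in> D \<and> arc k (\<not> s) 0 \<in> D) \<and>
     (\<forall>i. 1 \<le> i \<and> i < k \<longrightarrow> \<not> (arc k s i \<in> D \<and> arc k (\<not> s) (Suc i) \<in> D)) \<and>
     \<not> (chord s \<in> D \<and> arc k (\<not> s) 0 \<in> D \<and> arc k s 1 \<in> D) \<and>
     \<not> (chord s \<in> D \<and> arc k s k \<in> D \<and> arc k (\<not> s) (k + 1) \<in> D))"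

text \<open>The two excluded arcs are those that continue \<open>chord t\<close> around the
  triangle. While both are absent, no single legal move completes the triangle.\<close>

definition secure :: "nat \<Rightarrow> bool \<Rightarrow> vertex move set \<Rightarrow> bool" where
  "secure k t D \<longleftrightarrow> oriented k D \<and> balanced k D \<and> chord t \<in> D \<and>
     arc k t 0 \<notin> D \<and> arc k t (k + 1) \<notin> D"

section \<open>The graph in rim coordinates\<close>

context
  fixes k :: nat
  assumes k: "2 \<le> k"
begin

abbreviation "G \<equiv> j2k_graph (Suc 0) k"

lemma rim_eq_iff:
  assumes "i \<le> k + 2" "j \<le> k + 2"
  shows "rim k i = rim k j \<longleftrightarrow> i = j \<or> (i = 0 \<and> j = k + 2) \<or> (i = k + 2 \<and> j = 0)"
  using assms k by (auto simp: rim_def split: if_splits)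

lemma lower_path_nth: "i \<le> k \<Longrightarrow> lower_path k ! i = rim k (Suc i)"
  using k by (auto simp: lower_path_def rim_def nth_Cons nth_append split: nat.split)

lemma length_lower_path: "length (lower_path k) = k + 1"
  using k by (simp add: lower_path_def)

lemma rim_ends: "rim k 0 = Middle" "rim k (Suc 0) = LeftEnd" "rim k (Suc k) = RightEnd"
    "rim k (Suc (Suc k)) = Middle"
  using k by (auto simp: rim_def)

lemma edges_rim: "edges G = {{rim k i, rim k (Suc i)} | i. i \<le> k + 1} \<union> {{LeftEnd, RightEnd}}"
proof -
  have "path_edges (lower_path k) = {{rim k i, rim k (Suc i)} | i. 1 \<le> i \<and> i \<le> k}" (is "?L = ?R")
  proof
    show "?L \<subseteq> ?R"
      by (force simp: path_edges_def length_lower_path lower_path_nth)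
    show "?R \<subseteq> ?L"
    proof
      fix e assume "e \<in> ?R"
      then obtain i where i: "e = {rim k i, rim k (Suc i)}" "1 \<le> i" "i \<le> k" by auto
      then show "e \<in> ?L"
        unfolding path_edges_def
        by (auto simp: length_lower_path lower_path_nth intro!: exI[of _ "i - 1"])
    qed
  qed
  moreover have "path_edges (upper_path (Suc 0)) = {{LeftEnd, RightEnd}}"
    by (auto simp: path_edges_def upper_path_def)
  moreover have "{{rim k i, rim k (Suc i)} | i. i \<le> k + 1} =
      {{LeftEnd, Middle}, {Middle, RightEnd}} \<union> {{rim k i, rim k (Suc i)} | i. 1 \<le> i \<and> i \<le> k}"
  proof -
    have "{i. i \<le> k + 1} = {0, k + 1} \<union> {i. 1 \<le> i \<and> i \<le> k}" by auto
    then have "(\<lambda>i. {rim k i, rim k (Suc i)}) ` {i. i \<le> k + 1} =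
        (\<lambda>i. {rim k i, rim k (Suc i)}) ` ({0, k + 1} \<union> {i. 1 \<le> i \<and> i \<le> k})" by simp
    then show ?thesis by (auto simp: rim_ends image_Un setcompr_eq_image)
  qed
  ultimately show ?thesis by (auto simp: j2k_graph_def middle_path_edges)
qed

lemma verts_rim: "verts G = rim k ` {..k + 1}"
proof -
  have "set (lower_path k) = rim k ` {1..k + 1}"
  proof -
    have "set (lower_path k) = (\<lambda>i. lower_path k ! i) ` {..k}"
      using length_lower_path by (auto simp: set_conv_nth image_def less_Suc_eq_le)
    also have "\<dots> = (\<lambda>i. rim k (Suc i)) ` {..k}" by (auto simp: lower_path_nth)
    also have "\<dots> = rim k ` (Suc ` {..k})" by (simp add: image_image)
    also have "Suc ` {..k} = {1..k + 1}" by (auto simp: image_Suc_atMost)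
    finally show ?thesis .
  qed
  moreover have "{..k + 1} = insert 0 {1..k + 1}" by auto
  moreover have "LeftEnd \<in> rim k ` {1..k + 1}" "RightEnd \<in> rim k ` {1..k + 1}"
    by (auto simp: image_iff rim_ends intro: bexI[of _ 1] bexI[of _ "k + 1"])
  ultimately show ?thesis
    by (auto simp: j2k_graph_def upper_path_def middle_path_def rim_ends)
qed

lemma chord_rim: "chord s = (if s then (rim k 1, rim k (k + 1)) else (rim k (k + 1), rim k 1))"
  by (simp add: chord_def rim_ends)

lemma arc_eq_iff:
  assumes "i \<le> k + 1" "j \<le> k + 1"
  shows "arc k s i = arc k s' j \<longleftrightarrow> s = s' \<and> i = j"
  using assms k by (auto simp: arc_def rim_eq_iff split: if_splits)

text \<open>The lower path has an inner vertex by \<open>2 \<le> k\<close>, so none of its edges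
  joins both ends.\<close>

lemma arc_neq_chord: "i \<le> k + 1 \<Longrightarrow> arc k s i \<noteq> chord s'"
    "i \<le> k + 1 \<Longrightarrow> chord s' \<noteq> arc k s i"
  using k by (auto simp: arc_def chord_rim rim_eq_iff split: if_splits)

lemma chord_eq_iff: "chord s = chord s' \<longleftrightarrow> s = s'"
  by (auto simp: chord_def)

lemmas move_eqs = arc_eq_iff arc_neq_chord chord_eq_iff

lemma move_cases:
  assumes "{v, w} \<in> edges G"
  obtains s i where "(v, w) = arc k s i" "i \<le> k + 1" | s where "(v, w) = chord s"
proof -
  have arcs: "arc k True i = (rim k i, rim k (Suc i))" "arc k False i = (rim k (Suc i), rim k i)"
    for i by (simp_all add: arc_def)
  have chords: "chord True = (LeftEnd, RightEnd)" "chord False = (RightEnd, LeftEnd)"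
    by (simp_all add: chord_def)
  consider i where "{v, w} = {rim k i, rim k (Suc i)}" "i \<le> k + 1" | "{v, w} = {LeftEnd, RightEnd}"
    using assms unfolding edges_rim by blast
  then show ?thesis
  proof cases
    case 1
    then show ?thesis using that(1) arcs unfolding doubleton_eq_iff by metis
  next
    case 2
    then show ?thesis using that(2) chords unfolding doubleton_eq_iff by metis
  qed
qed

lemma arc_edge: "i \<le> k + 1 \<Longrightarrow> {fst (arc k s i), snd (arc k s i)} \<in> edges G"
  by (auto simp: edges_rim arc_def insert_commute)

lemma chord_edge: "{fst (chord s), snd (chord s)} \<in> edges G"
  by (auto simp: edges_rim chord_def insert_commute)

lemma swap_arc: "(snd (arc k s i), fst (arc k s i)) = arc k (\<not> s) i"
  by (simp add: arc_def)

lemma swap_chord: "(snd (chord s), fst (chord s)) = chord (\<not> s)"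
  by (simp add: chord_def)

lemma neighbours:
  assumes "j \<le> k + 1"
  shows "{u, rim k j} \<in> edges G \<longleftrightarrow>
    u = rim k (Suc j) \<or> u = rim k (if j = 0 then k + 1 else j - 1) \<or>
    (j = 1 \<and> u = rim k (k + 1)) \<or> (j = k + 1 \<and> u = rim k 1)" (is "?L \<longleftrightarrow> ?R")
proof
  assume ?L
  then consider i where "i \<le> k + 1" "u = rim k i" "rim k j = rim k (Suc i)"
    | i where "i \<le> k + 1" "u = rim k (Suc i)" "rim k j = rim k i"
    | "u = rim k 1" "rim k j = rim k (k + 1)" | "u = rim k (k + 1)" "rim k j = rim k 1"
    unfolding edges_rim by (auto simp: doubleton_eq_iff rim_ends)
  then show ?R
    using assms k by cases (auto simp: rim_eq_iff)
next
  have *: "{rim k i, rim k (Suc i)} \<in> edges G" if "i \<le> k + 1" for i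
    using that by (auto simp: edges_rim)
  have c: "{rim k 1, rim k (k + 1)} \<in> edges G"
    by (simp add: edges_rim rim_ends)
  assume ?R
  then consider "u = rim k (Suc j)" | "j = 0" "u = rim k (k + 1)" | "j > 0" "u = rim k (j - 1)"
    | "j = 1" "u = rim k (k + 1)" | "j = k + 1" "u = rim k 1"
    by (auto split: if_splits)
  then show ?L
  proof cases
    case 2
    then show ?thesis using *[of "k + 1"] by (simp add: rim_ends)
  next
    case 3
    then show ?thesis using *[of "j - 1"] assms by simp
  qed (use * c assms in \<open>auto simp: insert_commute\<close>)
qed

section \<open>Sinks, sources, legal moves and cells\<close>

lemma sink_iff:
  assumes "j \<le> k + 1"
  shows "is_sink G D (rim k j) \<longleftrightarrow> arc k False j \<in> D \<and>
      arc k True (if j = 0 then k + 1 else j - 1) \<in> D \<and>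
      (j = 1 \<longrightarrow> chord False \<in> D) \<and> (j = k + 1 \<longrightarrow> chord True \<in> D)"
  unfolding is_sink_def neighbours[OF assms] arc_def chord_rim
  by (auto simp: rim_ends)

lemma source_iff:
  assumes "j \<le> k + 1"
  shows "is_source G D (rim k j) \<longleftrightarrow> arc k True j \<in> D \<and>
      arc k False (if j = 0 then k + 1 else j - 1) \<in> D \<and>
      (j = 1 \<longrightarrow> chord True \<in> D) \<and> (j = k + 1 \<longrightarrow> chord False \<in> D)"
  unfolding is_source_def insert_commute[of "rim k j"] neighbours[OF assms] arc_def chord_rim
  by (auto simp: rim_ends)

lemma balanced_iff:
  "balanced k D \<longleftrightarrow> (\<forall>w \<in> verts G. \<not> is_sink G D w \<and> \<not> is_source G D w)"
proof -
  \<comment> \<open>The cases match the clauses of \<open>balanced\<close>: the middle vertex, the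
    two ends, and the inner vertices of the lower path.\<close>
  have "(\<forall>j \<le> k + 1. P j) \<longleftrightarrow> P 0 \<and> P 1 \<and> P (k + 1) \<and> (\<forall>i. 1 \<le> i \<and> i < k \<longrightarrow> P (Suc i))" for P
  proof -
    have "j = 0 \<or> j = 1 \<or> j = k + 1 \<or> (\<exists>i. 1 \<le> i \<and> i < k \<and> j = Suc i)" if "j \<le> k + 1" for j
      using that by (cases j) auto
    then show ?thesis by auto
  qed
  note split = this
  have "(\<forall>w \<in> verts G. \<not> is_sink G D w \<and> \<not> is_source G D w) \<longleftrightarrow>
      (\<forall>j \<le> k + 1. \<not> is_sink G D (rim k j) \<and> \<not> is_source G D (rim k j))"
    by (auto simp: verts_rim)
  also have "\<dots> \<longleftrightarrow> balanced k D"
  proof -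
    have 0: "is_sink G D (rim k 0) \<longleftrightarrow> arc k False 0 \<in> D \<and> arc k True (k + 1) \<in> D"
      "is_source G D (rim k 0) \<longleftrightarrow> arc k True 0 \<in> D \<and> arc k False (k + 1) \<in> D"
      using k by (simp_all add: sink_iff source_iff)
    have 1: "is_sink G D (rim k 1) \<longleftrightarrow> arc k False 1 \<in> D \<and> arc k True 0 \<in> D \<and> chord False \<in> D"
      "is_source G D (rim k 1) \<longleftrightarrow> arc k True 1 \<in> D \<and> arc k False 0 \<in> D \<and> chord True \<in> D"
      using k sink_iff[of 1] source_iff[of 1] by simp_all
    have 2: "is_sink G D (rim k (k + 1)) \<longleftrightarrow>
        arc k False (k + 1) \<in> D \<and> arc k True k \<in> D \<and> chord True \<in> D"
      "is_source G D (rim k (k + 1)) \<longleftrightarrow>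
        arc k True (k + 1) \<in> D \<and> arc k False k \<in> D \<and> chord False \<in> D"
      using k sink_iff[of "k + 1"] source_iff[of "k + 1"] by simp_all
    have 3: "is_sink G D (rim k (Suc i)) \<longleftrightarrow> arc k False (Suc i) \<in> D \<and> arc k True i \<in> D"
      "is_source G D (rim k (Suc i)) \<longleftrightarrow> arc k True (Suc i) \<in> D \<and> arc k False i \<in> D"
      if "1 \<le> i \<and> i < k" for i
      using that sink_iff[of "Suc i"] source_iff[of "Suc i"] by simp_all
    have 4: "(\<forall>i. 1 \<le> i \<and> i < k \<longrightarrow>
        \<not> is_sink G D (rim k (Suc i)) \<and> \<not> is_source G D (rim k (Suc i))) \<longleftrightarrow>
      (\<forall>i. 1 \<le> i \<and> i < k \<longrightarrow> \<not> (arc k True i \<in> D \<and> arc k False (Suc i) \<in> D)) \<and>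
      (\<forall>i. 1 \<le> i \<and> i < k \<longrightarrow> \<not> (arc k False i \<in> D \<and> arc k True (Suc i) \<in> D))"
      using 3 by blast
    show ?thesis
      unfolding split balanced_def all_bool_eq 0 1 2 4 not_False_eq_True not_True_eq_False by argo
  qed
  finally show ?thesis ..
qed

lemma legal_move_iff:
  "legal_move G D m \<longleftrightarrow> ((\<exists>s i. m = arc k s i \<and> i \<le> k + 1) \<or> (\<exists>s. m = chord s)) \<and>
     m \<notin> D \<and> (snd m, fst m) \<notin> D \<and> balanced k (insert m D)"
proof -
  have "{fst m, snd m} \<in> edges G \<longleftrightarrow> (\<exists>s i. m = arc k s i \<and> i \<le> k + 1) \<or> (\<exists>s. m = chord s)"
    using arc_edge chord_edge move_cases[of "fst m" "snd m"] by (metis prod.collapse)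
  then show ?thesis
    unfolding legal_move_def balanced_iff by blast
qed

lemma legal_arc:
  "i \<le> k + 1 \<Longrightarrow> legal_move G D (arc k s i) \<longleftrightarrow> \<not> marked k D i \<and> balanced k (insert (arc k s i) D)"
  unfolding legal_move_iff swap_arc marked_def by (cases s) (auto simp: ex_bool_eq)

lemma legal_chord:
  "legal_move G D (chord s) \<longleftrightarrow> chord True \<notin> D \<and> chord False \<notin> D \<and> balanced k (insert (chord s) D)"
  unfolding legal_move_iff swap_chord by (cases s) auto

lemma directed_around_iff:
  "directed_around D c \<longleftrightarrow> (\<exists>s. \<forall>i < length c.
     (if s then (c ! i, c ! (Suc i mod length c)) else (c ! (Suc i mod length c), c ! i)) \<in> D)"
  by (simp add: directed_around_def ex_bool_eq)

lemma has_cycle_cell_iff: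
  "has_cycle_cell G D \<longleftrightarrow>
     (\<exists>s. chord s \<in> D \<and> arc k s 0 \<in> D \<and> arc k s (k + 1) \<in> D) \<or> (\<exists>s. \<forall>i \<le> k + 1. arc k s i \<in> D)"
proof -
  have lt3: "(\<forall>i < Suc (Suc (Suc 0)). P i) \<longleftrightarrow> P 0 \<and> P 1 \<and> P (Suc 1)" for P
    by (auto simp: less_Suc_eq)
  have upper: "directed_around D (upper_path (Suc 0) @ [Middle]) \<longleftrightarrow>
     (\<exists>s. chord s \<in> D \<and> arc k s 0 \<in> D \<and> arc k s (k + 1) \<in> D)"
    unfolding directed_around_iff
    by (auto simp: upper_path_def lt3 chord_def arc_def rim_ends split: if_splits)
  define c where "c = lower_path k @ [Middle]"
  have len: "length c = k + 2" by (simp add: c_def length_lower_path)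
  \<comment> \<open>The list of the lower cell starts at \<open>LeftEnd\<close>, which is
    \<open>rim k 1\<close>, while the rim starts at the middle vertex; hence the shift by one, and
    arc \<open>0\<close> comes last.\<close>
  have nth: "c ! i = rim k (Suc i)" if "i \<le> k + 1" for i
    using that by (auto simp: c_def nth_append length_lower_path lower_path_nth rim_ends le_Suc_eq)
  have "(\<forall>i < length c.
     (if s then (c ! i, c ! (Suc i mod length c)) else (c ! (Suc i mod length c), c ! i)) \<in> D) \<longleftrightarrow>
     (\<forall>i \<le> k + 1. arc k s i \<in> D)" (is "?L \<longleftrightarrow> ?R") for s
  proof -
    have "(if s then (c ! i, c ! (Suc i mod length c)) else (c ! (Suc i mod length c), c ! i)) =
        arc k s (if i = k + 1 then 0 else Suc i)" if "i \<le> k + 1" for i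
      using that nth[of i] nth[of "Suc i"] nth[of 0] by (auto simp: len arc_def rim_ends)
    then have "?L \<longleftrightarrow> (\<forall>i \<le> k + 1. arc k s (if i = k + 1 then 0 else Suc i) \<in> D)"
      by (simp add: len less_Suc_eq_le)
    also have "\<dots> \<longleftrightarrow> ?R"
    proof
      assume *: "\<forall>i \<le> k + 1. arc k s (if i = k + 1 then 0 else Suc i) \<in> D"
      show ?R
      proof (intro allI impI)
        fix i assume "i \<le> k + 1"
        then show "arc k s i \<in> D"
          using *[rule_format, of "k + 1"] *[rule_format, of "i - 1"] by (cases i) auto
      qed
    qed auto
    finally show ?thesis .
  qed
  then have "directed_around D c \<longleftrightarrow> (\<exists>s. \<forall>i \<le> k + 1. arc k s i \<in> D)"
    by (simp add: directed_around_iff)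
  then show ?thesis
    using upper by (simp add: has_cycle_cell_def j2k_graph_def c_def)
qed

section \<open>Oriented and secure positions\<close>

lemma oriented_insert:
  assumes "oriented k D" "legal_move G D m"
  shows "oriented k (insert m D)"
proof -
  from assms(2) consider s i where "m = arc k s i" "i \<le> k + 1" | s where "m = chord s"
    unfolding legal_move_iff by blast
  then show ?thesis
  proof cases
    case 1
    then have "\<not> marked k D i" using assms(2) by (simp add: legal_arc)
    then show ?thesis using assms(1) 1 by (auto simp: oriented_def marked_def move_eqs)
  next
    case 2
    then have "chord True \<notin> D" "chord False \<notin> D" using assms(2) by (simp_all add: legal_chord)
    then show ?thesis using assms(1) 2 by (auto simp: oriented_def move_eqs)
  qed
qed

lemma oriented_finite: "oriented k D \<Longrightarrow> finite D"
  unfolding oriented_def by (elim conjE finite_subset) simp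

lemma oriented_arc: "oriented k D \<Longrightarrow> i \<le> k + 1 \<Longrightarrow> arc k s i \<in> D \<Longrightarrow> arc k s' i \<in> D \<longleftrightarrow> s' = s"
  unfolding oriented_def by (cases s; cases s') auto

lemma oriented_chord: "oriented k D \<Longrightarrow> chord s \<in> D \<Longrightarrow> chord s' \<in> D \<longleftrightarrow> s' = s"
  unfolding oriented_def by (cases s; cases s') auto

lemma card_secure:
  assumes "secure k t D"
  shows "card D = Suc (card {i. i \<le> k + 1 \<and> marked k D i})"
proof -
  let ?M = "{i. i \<le> k + 1 \<and> marked k D i}"
  \<comment> \<open>For a marked \<open>i\<close> this is the one direction in which arc
    \<open>i\<close> occurs in \<open>D\<close>: if it is not \<open>True\<close>, it is
    \<open>False\<close>.\<close>
  let ?f = "\<lambda>i. arc k (arc k True i \<in> D) i"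
  have o: "oriented k D" and c: "chord t \<in> D" using assms by (auto simp: secure_def)
  have f: "?f i \<in> D" if "i \<in> ?M" for i
    using that by (auto simp: marked_def) (metis (full_types))
  have "D = insert (chord t) (?f ` ?M)"
  proof
    show "D \<subseteq> insert (chord t) (?f ` ?M)"
    proof
      fix m assume m: "m \<in> D"
      then consider s i where "m = arc k s i" "i \<le> k + 1" | s where "m = chord s"
        using o unfolding oriented_def by auto
      then show "m \<in> insert (chord t) (?f ` ?M)"
      proof cases
        case 1
        then have "i \<in> ?M" using m by (auto simp: marked_def)
        moreover have "m = ?f i"
          using oriented_arc[OF o 1(2), of s True] m 1 by auto
        ultimately show ?thesis by blast
      next
        case 2
        then show ?thesis using oriented_chord[OF o c, of s] m by simp
      qed
    qed
    show "insert (chord t) (?f ` ?M) \<subseteq> D" using c f by blast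
  qed
  moreover have "chord t \<notin> ?f ` ?M" by (auto simp: move_eqs)
  moreover have "inj_on ?f ?M" by (auto simp: inj_on_def move_eqs)
  ultimately show ?thesis by (metis (no_types, lifting) card_image card_insert_disjoint finite_imageI
        finite_nat_set_iff_bounded_le mem_Collect_eq)
qed

text \<open>A sink or source at an inner vertex of the lower path needs two adjacent opposite arcs,
  which \<open>left\<close> and \<open>right\<close> exclude. At the ends the chord has direction
  \<open>t\<close>, so again adjacent opposite arcs would be needed. At the middle vertex one of the
  two middle edges would need direction \<open>t\<close>.\<close>

lemma balanced_insert_arc:
  assumes "secure k t D" "i \<le> k + 1" and ends: "i = 0 \<or> i = k + 1 \<Longrightarrow> t \<noteq> s"
    and left: "1 \<le> i \<Longrightarrow> arc k (\<not> s) (i - 1) \<notin> D"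
    and right: "i \<le> k \<Longrightarrow> arc k (\<not> s) (Suc i) \<notin> D"
  shows "balanced k (insert (arc k s i) D)"
proof -
  define E where "E = insert (arc k s i) D"
  have b: "balanced k D" and c: "chord s' \<in> D \<longleftrightarrow> s' = t"
    and e: "arc k t 0 \<notin> D" "arc k t (k + 1) \<notin> D" for s'
    using assms(1) oriented_chord by (auto simp: secure_def)
  have c': "chord s' \<in> E \<longleftrightarrow> s' = t" for s'
    using c assms(2) by (simp add: E_def move_eqs)
  have mem: "arc k s' j \<in> E \<longleftrightarrow> (s' = s \<and> j = i) \<or> arc k s' j \<in> D" if "j \<le> k + 1" for s' j
    using that assms(2) by (simp add: E_def move_eqs)
  have e': "arc k t 0 \<notin> E" "arc k t (k + 1) \<notin> E"
    using e ends mem[OF le0] mem[OF order_refl] by blast+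
  have "\<not> (arc k (\<not> t) 0 \<in> E \<and> arc k t 1 \<in> E)"
  proof
    assume *: "arc k (\<not> t) 0 \<in> E \<and> arc k t 1 \<in> E"
    have "\<not> (arc k (\<not> t) 0 \<in> D \<and> arc k t 1 \<in> D)"
      using b c[of t] unfolding balanced_def by blast
    moreover have "1 \<le> k + 1" by simp
    \<comment> \<open>The bad pair is not contained in \<open>D\<close>, so one of its arcs is the
      new one and the other is an opposite neighbour of it in \<open>D\<close>.\<close>
    ultimately consider "i = 0" "s = (\<not> t)" "arc k t 1 \<in> D" | "i = 1" "s = t" "arc k (\<not> t) 0 \<in> D"
      using * mem[OF le0] mem[of 1] by (metis zero_neq_one)
    then show False
      using left right by cases simp_all
  qed
  moreover have "\<not> (arc k t k \<in> E \<and> arc k (\<not> t) (k + 1) \<in> E)"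
  proof
    assume *: "arc k t k \<in> E \<and> arc k (\<not> t) (k + 1) \<in> E"
    have "\<not> (arc k t k \<in> D \<and> arc k (\<not> t) (k + 1) \<in> D)"
      using b c[of t] unfolding balanced_def by blast
    moreover have "k \<le> k + 1" "k \<noteq> k + 1" by simp_all
    ultimately consider "i = k + 1" "s = (\<not> t)" "arc k t k \<in> D"
      | "i = k" "s = t" "arc k (\<not> t) (k + 1) \<in> D"
      using * mem[OF order_refl] mem[of k] by metis
    then show False
      using left right by cases simp_all
  qed
  \<comment> \<open>One of \<open>s'\<close> and \<open>\<not> s'\<close> equals \<open>t\<close>,
    and no middle edge has direction \<open>t\<close>.\<close>
  moreover have "\<not> (arc k s' (k + 1) \<in> E \<and> arc k (\<not> s') 0 \<in> E)" for s'
    using e' by (cases "s' = t") simp_all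
  moreover have "\<not> (arc k s' j \<in> E \<and> arc k (\<not> s') (Suc j) \<in> E)" if j: "1 \<le> j \<and> j < k" for s' j
  proof
    assume *: "arc k s' j \<in> E \<and> arc k (\<not> s') (Suc j) \<in> E"
    have "\<not> (arc k s' j \<in> D \<and> arc k (\<not> s') (Suc j) \<in> D)"
      using b j unfolding balanced_def by blast
    moreover have "j \<le> k + 1" "Suc j \<le> k + 1" "j \<noteq> Suc j" using j by simp_all
    ultimately consider "i = j" "s = s'" "arc k (\<not> s') (Suc j) \<in> D"
      | "i = Suc j" "s = (\<not> s')" "arc k s' j \<in> D"
      using * mem by metis
    then show False
      using left right j by cases simp_all
  qed
  ultimately have "balanced k E"
    unfolding balanced_def c' by blast
  then show ?thesis by (simp add: E_def)
qed

section \<open>Parity of stuck positions\<close>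

text \<open>The number of undirected arcs is even by \<open>even_gaps\<close>. Hence the number of
  directed ones among all \<open>k + 2\<close> has the parity of \<open>k\<close>, and the chord
  adds one more move.\<close>

lemma even_card_if_stuck:
  assumes sec: "secure k t D"
    and stuck: "\<And>m. legal_move G D m \<Longrightarrow> m = arc k t 0 \<or> m = arc k t (k + 1)"
  shows "even (card D) \<longleftrightarrow> odd k"
proof -
  have o: "oriented k D" and b: "balanced k D" and c: "chord t \<in> D"
    and e: "arc k t 0 \<notin> D" "arc k t (k + 1) \<notin> D"
    using sec by (auto simp: secure_def)
  txt \<open>
    The directions along the rim, with a virtual edge of direction \<open>\<not> t\<close> at both ends.  The virtual
    edges encode the effect of the chord on the middle edges, so that an undirected middle edge
    that cannot get the direction \<open>\<not> t\<close> also lies between two opposite directions.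
  \<close>
  define y where "y i = (case i of 0 \<Rightarrow> Some (\<not> t) | Suc j \<Rightarrow>
     if k + 1 < j then Some (\<not> t) else if marked k D j then Some (arc k True j \<in> D) else None)" for i
  have y0: "y 0 = Some (\<not> t)" and yn: "y (k + 3) = Some (\<not> t)"
    by (simp_all add: y_def numeral_3_eq_3)
  have y_Some: "y (Suc j) = Some s \<longleftrightarrow> arc k s j \<in> D" if "j \<le> k + 1" for j s
  proof -
    have "\<not> (arc k True j \<in> D \<and> arc k False j \<in> D)"
      using o that by (simp add: oriented_def)
    then show ?thesis
      using that by (cases s) (auto simp: y_def marked_def ex_bool_eq)
  qed
  have y_None: "y (Suc j) = None \<longleftrightarrow> \<not> marked k D j" if "j \<le> k + 1" for j
    using that by (simp add: y_def)
  have "even (card {i. i < k + 3 \<and> y i = None}) \<longleftrightarrow> (\<not> t) = (\<not> t)"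
  proof (rule even_gaps[where y = y])
    show "y 0 = Some (\<not> t)" "y (k + 3) = Some (\<not> t)" by fact+
  next
    fix i s assume i: "i < k + 3" "y i = Some s"
    show "y (Suc i) \<noteq> Some (\<not> s)"
    proof
      assume *: "y (Suc i) = Some (\<not> s)"
      have "\<exists>j. i = Suc j \<and> 1 \<le> j \<and> j < k"
        if "i \<noteq> 0" "i \<noteq> k + 2" "i \<noteq> 1" "i \<noteq> k + 1"
        using that i(1) by (cases i) auto
      then consider "i = 0" | "i = k + 2" | "i = 1" | "i = k + 1"
        | j where "i = Suc j" "1 \<le> j" "j < k" by blast
      then show False
      proof cases
        case 1
        then have "s = (\<not> t)" using y0 i(2) by simp
        then have "y (Suc 0) = Some t" using * unfolding \<open>i = 0\<close> by simp
        then show ?thesis using e y_Some[OF le0] by blast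
      next
        case 2
        then have "y (Suc i) = Some (\<not> t)" using yn by (simp add: numeral_3_eq_3)
        then have "s = t" using * by simp
        then have "y (Suc (k + 1)) = Some t" using i(2) unfolding \<open>i = k + 2\<close> by simp
        then show ?thesis using e y_Some[OF order_refl] by blast
      next
        case 3
        then have "arc k s 0 \<in> D" "arc k (\<not> s) 1 \<in> D"
          using y_Some[OF le0, of s] y_Some[of 1 "\<not> s"] i(2) * by simp_all
        \<comment> \<open>Since \<open>arc k t 0\<close> is absent, \<open>s\<close> is
          \<open>\<not> t\<close>. Then the chord, the middle edge and arc \<open>1\<close> would
          make \<open>LeftEnd\<close> a sink or a source. The next case is the mirror image at
          \<open>RightEnd\<close>.\<close>
        then show ?thesis using e b c unfolding balanced_def by (cases "s = t") force+
      next
        case 4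
        then have "arc k s k \<in> D" "arc k (\<not> s) (k + 1) \<in> D"
          using y_Some[of k s] y_Some[OF order_refl, of "\<not> s"] i(2) * by simp_all
        then show ?thesis using e b c unfolding balanced_def by (cases "s = t") force+
      next
        case 5
        then have "arc k s j \<in> D" "arc k (\<not> s) (Suc j) \<in> D"
          using y_Some[of j s] y_Some[of "Suc j" "\<not> s"] i(2) * by simp_all
        then show ?thesis using b 5 unfolding balanced_def by blast
      qed
    qed
  next
    fix i assume "Suc i < k + 3" "y (Suc i) = None"
    then have i: "i \<le> k + 1" "\<not> marked k D i" using y_None[of i] by auto
    \<comment> \<open>If neither neighbour opposed \<open>s\<close>, then \<open>arc k s i\<close>
      would be legal by \<open>balanced_insert_arc\<close>, and it would not be one of the two moves
      that \<open>stuck\<close> allows.\<close>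
    have conflict: "y i = Some (\<not> s) \<or> y (Suc (Suc i)) = Some (\<not> s)" for s
    proof (rule ccontr)
      assume *: "\<not> ?thesis"
      \<comment> \<open>At a middle edge the virtual neighbour, of direction
        \<open>\<not> t\<close>, already opposes \<open>t\<close>.\<close>
      have "t \<noteq> s" if "i = 0 \<or> i = k + 1"
      proof
        assume "t = s"
        moreover have "y i = Some (\<not> t) \<or> y (Suc (Suc i)) = Some (\<not> t)"
          using that y0 yn by (auto simp: numeral_3_eq_3)
        ultimately show False using * by blast
      qed
      moreover have "arc k (\<not> s) (i - 1) \<notin> D" if "1 \<le> i"
        using that * i y_Some[of "i - 1"] by auto
      moreover have "arc k (\<not> s) (Suc i) \<notin> D" if "i \<le> k"
        using that * y_Some[of "Suc i"] by auto
      ultimately have "balanced k (insert (arc k s i) D)" "i = 0 \<or> i = k + 1 \<longrightarrow> t \<noteq> s"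
        using balanced_insert_arc[OF sec i(1)] by blast+
      then show False
        using stuck[of "arc k s i"] i legal_arc[OF i(1)] arc_eq_iff[OF i(1) le0, of s t]
          arc_eq_iff[OF i(1) order_refl, of s t] by blast
    qed
    \<comment> \<open>Each of the two directions is opposed by some neighbour, so the neighbours
      carry different values.\<close>
    show "\<exists>s. y i = Some s \<and> y (Suc (Suc i)) = Some (\<not> s)"
      using conflict[of True] conflict[of False] by auto
  qed
  moreover have "{i. i < k + 3 \<and> y i = None} = Suc ` {j. j \<le> k + 1 \<and> \<not> marked k D j}"
  proof (intro set_eqI iffI)
    fix i assume "i \<in> {i. i < k + 3 \<and> y i = None}"
    then show "i \<in> Suc ` {j. j \<le> k + 1 \<and> \<not> marked k D j}"
      using y0 y_None[of "i - 1"] by (cases i) auto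
  qed (auto simp: y_None)
  ultimately have "even (card {j. j \<le> k + 1 \<and> \<not> marked k D j})"
    by (simp add: card_image)
  moreover have "card {j. j \<le> k + 1 \<and> marked k D j} + card {j. j \<le> k + 1 \<and> \<not> marked k D j} = k + 2"
  proof -
    have "{j. j \<le> k + 1 \<and> marked k D j} \<union> {j. j \<le> k + 1 \<and> \<not> marked k D j} = {..k + 1}" by auto
    then show ?thesis by (subst card_Un_disjoint[symmetric]) auto
  qed
  ultimately show ?thesis
    unfolding card_secure[OF sec] by presburger
qed

section \<open>Replies of the winner\<close>

text \<open>By \<open>even_card_if_stuck\<close> a position with only triangle-continuing moves left
  has the other parity. So a move different from these exists here, and it keeps the position
  secure.\<close>

lemma secure_reply:
  assumes sec: "secure k t D" and par: "even (card D) \<longleftrightarrow> even k"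
  shows "\<not> game_over G D \<and> (\<exists>m. legal_move G D m \<and> secure k t (insert m D) \<and>
    (even (card (insert m D)) \<longleftrightarrow> odd k))"
proof -
  obtain m where m: "legal_move G D m" "m \<noteq> arc k t 0" "m \<noteq> arc k t (k + 1)"
    using even_card_if_stuck[OF sec] par by blast
  have o: "oriented k D" and c: "chord t \<in> D"
    and e: "arc k t 0 \<notin> D" "arc k t (k + 1) \<notin> D"
    using sec by (auto simp: secure_def)
  have "secure k t (insert m D)"
    using sec m oriented_insert[OF o m(1)] by (auto simp: secure_def legal_move_iff)
  moreover have "card (insert m D) = Suc (card D)"
    using m(1) oriented_finite[OF o] by (simp add: legal_move_iff)
  \<comment> \<open>The chord is already directed, so \<open>m\<close> directs an arc. That arc is
    still undirected in \<open>D\<close>, which leaves the lower cell incomplete.\<close>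
  moreover have "\<not> has_cycle_cell G D"
  proof -
    have "m \<noteq> chord s" for s
      using m(1) c by (cases s; cases t) (auto simp: legal_chord)
    then obtain s i where "m = arc k s i" "i \<le> k + 1"
      using m(1) unfolding legal_move_iff by blast
    then have "\<not> (\<exists>s. \<forall>i \<le> k + 1. arc k s i \<in> D)"
      using m(1) by (auto simp: legal_arc marked_def)
    then show ?thesis
      using oriented_chord[OF o c] e by (auto simp: has_cycle_cell_iff)
  qed
  moreover have "even (Suc (card D)) \<longleftrightarrow> odd k" using par by simp
  ultimately show ?thesis using m(1) unfolding game_over_def by metis
qed

text \<open>Once one middle edge continues the chord, the other cannot be directed against it
  without making the middle vertex a sink or a source. So it is still undirected, and giving it
  direction \<open>t\<close> completes the triangle.\<close>

lemma secure_triangle: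
  assumes sec: "secure k t D" and m: "legal_move G D m"
    and ends: "m = arc k t 0 \<and> n = k + 1 \<or> m = arc k t (k + 1) \<and> n = 0"
  shows "\<not> game_over G (insert m D) \<and> legal_move G (insert m D) (arc k t n) \<and>
    game_over G (insert (arc k t n) (insert m D))"
proof -
  let ?D = "insert m D"
  have o: "oriented k D" and c: "chord t \<in> D"
    and e: "arc k t 0 \<notin> D" "arc k t (k + 1) \<notin> D"
    using sec by (auto simp: secure_def)
  have o': "oriented k ?D" using oriented_insert[OF o m] .
  have b': "balanced k ?D" using m by (simp add: legal_move_iff)
  have c': "chord s \<in> ?D \<longleftrightarrow> s = t" for s using oriented_chord[OF o'] c by blast
  have n: "n \<le> k + 1" using ends by auto
  have free: "arc k s n \<notin> ?D" for s
  proof (cases "s = t")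
    case True
    have "arc k t n \<noteq> m" using ends arc_eq_iff[of 0 "k + 1" t t] by force
    then show ?thesis using True ends e by blast
  next
    case False
    then have s: "s = (\<not> t)" by simp
    have *: "\<not> (arc k s' (k + 1) \<in> ?D \<and> arc k (\<not> s') 0 \<in> ?D)" for s'
      using b' unfolding balanced_def by blast
    show ?thesis
      using ends
    proof (elim disjE conjE)
      assume "m = arc k t 0" "n = k + 1"
      then show ?thesis using *[of "\<not> t"] s by simp
    next
      assume "m = arc k t (k + 1)" "n = 0"
      then show ?thesis using *[of t] s by simp
    qed
  qed
  define E where "E = insert (arc k t n) ?D"
  have mem: "arc k s j \<in> E \<longleftrightarrow> (s = t \<and> j = n) \<or> arc k s j \<in> ?D" if "j \<le> k + 1" for s j
    using that n by (simp add: E_def arc_eq_iff)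
  have "arc k (\<not> t) 0 \<notin> ?D \<and> arc k (\<not> t) (k + 1) \<notin> ?D"
    using ends
  proof (elim disjE conjE)
    assume "m = arc k t 0" "n = k + 1"
    then show ?thesis using free[of "\<not> t"] oriented_arc[OF o' le0, of t "\<not> t"] by simp
  next
    assume "m = arc k t (k + 1)" "n = 0"
    then show ?thesis using free[of "\<not> t"] oriented_arc[OF o' order_refl, of t "\<not> t"] by simp
  qed
  then have against: "arc k (\<not> t) 0 \<notin> E" "arc k (\<not> t) (k + 1) \<notin> E"
    using mem[OF le0, of "\<not> t"] mem[OF order_refl, of "\<not> t"] by simp_all
  have chords: "chord s \<in> E \<longleftrightarrow> s = t" for s
    using c'[of s] n by (simp add: E_def arc_neq_chord)
  \<comment> \<open>A sink or source at the middle vertex or at an end would need a middle edge of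
    direction \<open>\<not> t\<close>. The inner vertices of the lower path are not touched by the
    new arc.\<close>
  have "balanced k E"
    unfolding balanced_def
  proof (intro allI conjI impI)
    fix s
    show "\<not> (arc k s (k + 1) \<in> E \<and> arc k (\<not> s) 0 \<in> E)"
      using against by (cases "s = t") simp_all
    show "\<not> (chord s \<in> E \<and> arc k (\<not> s) 0 \<in> E \<and> arc k s 1 \<in> E)"
      "\<not> (chord s \<in> E \<and> arc k s k \<in> E \<and> arc k (\<not> s) (k + 1) \<in> E)"
      using against chords[of s] by (cases "s = t"; simp)+
    fix i assume i: "1 \<le> i \<and> i < k"
    have "n = 0 \<or> n = k + 1" using ends by blast
    then have "i \<noteq> n" "Suc i \<noteq> n" "i \<le> k + 1" "Suc i \<le> k + 1" using i by auto
    then have "arc k s i \<in> E \<longleftrightarrow> arc k s i \<in> ?D"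
      "arc k (\<not> s) (Suc i) \<in> E \<longleftrightarrow> arc k (\<not> s) (Suc i) \<in> ?D"
      using mem by blast+
    then show "\<not> (arc k s i \<in> E \<and> arc k (\<not> s) (Suc i) \<in> E)"
      using b' i unfolding balanced_def by blast
  qed
  then have "balanced k (insert (arc k t n) ?D)" by (simp only: E_def)
  then have leg: "legal_move G ?D (arc k t n)"
    using free n by (auto simp: legal_arc marked_def)
  have "\<not> has_cycle_cell G ?D"
    unfolding has_cycle_cell_iff using free n ends le0 by blast
  moreover have "has_cycle_cell G (insert (arc k t n) ?D)"
    unfolding has_cycle_cell_iff using c ends by blast
  ultimately show ?thesis using leg unfolding game_over_def by blast
qed

section \<open>Opening moves and the final induction\<close>

text \<open>Both cells contain both middle edges, so completing one takes at least two
  moves.\<close>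

lemma no_cell_in_singleton: "\<not> has_cycle_cell G {m}"
proof
  assume "has_cycle_cell G {m}"
  then obtain s where "arc k s 0 = m" "arc k s (k + 1) = m"
    by (auto simp: has_cycle_cell_iff)
  then show False using arc_eq_iff[of 0 "k + 1" s s] by simp
qed

lemma secure_chord: "secure k t {chord t}"
  using k by (auto simp: secure_def oriented_def balanced_def move_eqs)

lemma legal_first_chord: "legal_move G {} (chord t)"
  using secure_chord[of t] by (simp add: legal_chord secure_def)

text \<open>This is the opening of Player 2. If Player 1 takes the chord, the position is secure
  with one move made, an odd number like \<open>k\<close>, so \<open>secure_reply\<close> applies.
  Otherwise Player 2 takes the chord.\<close>

lemma second_move:
  assumes "odd k" and m: "legal_move G {} m"
  shows "\<not> game_over G {m} \<and> (\<exists>m'. legal_move G {m} m' \<and>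
    (\<exists>t. secure k t {m', m} \<and> (even (card {m', m}) \<longleftrightarrow> odd k)))"
proof -
  from m consider t where "m = chord t" | s i where "m = arc k s i" "i \<le> k + 1"
    unfolding legal_move_iff by blast
  then show ?thesis
  proof cases
    case 1
    then show ?thesis using secure_reply[OF secure_chord[of t]] \<open>odd k\<close> by auto
  next
    case 2
    \<comment> \<open>The chord is directed so that the arc of Player 1, should it be a middle edge,
      does not continue it around the triangle.\<close>
    define t where "t = (\<not> s)"
    have bal: "balanced k {chord t, m}"
      using k 2 by (auto simp: balanced_def move_eqs)
    then have leg: "legal_move G {m} (chord t)"
      using 2 by (auto simp: legal_chord move_eqs)
    moreover have "secure k t {chord t, m}"
      using bal 2 by (auto simp: secure_def oriented_def move_eqs t_def)
    moreover have "card {chord t, m} = 2" using 2 by (simp add: move_eqs)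
    ultimately show ?thesis
      using no_cell_in_singleton \<open>odd k\<close> unfolding game_over_def by (metis even_numeral)
  qed
qed

lemma has_winning_strategy_by_parity:
  assumes "if p = Player1 then even k else odd k"
  shows "has_winning_strategy G p"
proof (rule has_winning_strategyI)
  \<comment> \<open>The disjuncts are the start when Player 2 is to win, a game just finished by the
    winner's triangle, and a secure position left to the opponent. The parity of the last is the one
    that his next move turns into that required by \<open>secure_reply\<close>.\<close>
  let ?Inv = "\<lambda>D. D = {} \<and> odd k \<or> game_over G D \<or>
    (\<exists>t. secure k t D \<and> (even (card D) \<longleftrightarrow> odd k))"
  show "\<not> game_over G {}"
    using legal_first_chord unfolding game_over_def has_cycle_cell_iff by blast
  show "\<exists>m. legal_move G {} m \<and> ?Inv {m}" if "p = Player1"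
  proof (intro exI conjI)
    show "legal_move G {} (chord True)" by (rule legal_first_chord)
    show "?Inv {chord True}" using secure_chord[of True] that assms by auto
  qed
  show "?Inv {}" if "p = Player2" using that assms by simp
  fix D m
  assume inv: "?Inv D" and "\<not> game_over G D" and m: "legal_move G D m"
  then consider "D = {}" "odd k" | t where "secure k t D" "even (card D) \<longleftrightarrow> odd k" by blast
  then show "\<not> game_over G (insert m D) \<and>
    (\<exists>m'. legal_move G (insert m D) m' \<and> ?Inv (insert m' (insert m D)))"
  proof cases
    case 1
    then show ?thesis using second_move m by blast
  next
    case 2
    show ?thesis
    proof (cases "m = arc k t 0 \<or> m = arc k t (k + 1)")
      case True
      then show ?thesis using secure_triangle[OF 2(1) m] by blast
    next
      case False
      have o: "oriented k D" using 2(1) by (simp add: secure_def)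
      \<comment> \<open>Any move of the opponent that does not continue the chord keeps the position
        secure.\<close>
      have "secure k t (insert m D)"
        using 2(1) m False oriented_insert[OF o m] by (auto simp: secure_def legal_move_iff)
      moreover have "even (card (insert m D)) \<longleftrightarrow> even k"
        using m oriented_finite[OF o] 2(2) by (simp add: legal_move_iff)
      ultimately show ?thesis using secure_reply by blast
    qed
  qed
qed

end

theorem theorem4:
  fixes k :: nat
  assumes "k \<ge> 4"
  shows "(even k \<longrightarrow> has_winning_strategy (j2k_graph 1 k) Player1) \<and>
         (odd k \<longrightarrow> has_winning_strategy (j2k_graph 1 k) Player2)"
  using has_winning_strategy_by_parity[of k Player1] has_winning_strategy_by_parity[of k Player2] assms by simp

end
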